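(* Consider the piecewise smooth vector field $Z^*=(X^*,Y^* )$ (equal to $X^*$ for $y>0$ and $Y^*$ for $y<0$) with $$X^*(x,y)=(y,x),\qquad Y^*(x,y)=\left(x+\tfrac12\Gamma(x,y),\ x+y+\tfrac12\Gamma(x,y)\right),$$ where $$\Gamma(x,y)=\begin{cases}\left(x^2+y^2\right)^{1/2}\left(-\tfrac12\ln(x^2+y^2)\right)^{-3/2}&\text{if }0<x^2+y^2<1,\\ 0&\text{if }x^2+y^2=0.\end{cases}$$ Then $Z^*\in\Omega_0$, and $Z^*$ is not locally $\Sigma$-equivalent near the origin to its linear part $Z_L^*=(X_L^*,Y_L^* )$, where $X_L^*(x,y)=(y,x)$ and $Y_L^*(x,y)=(x,\ x+y)$.
   Context: Let $\mathcal U\subset\mathbb R^2$ be a bounded open set containing the origin $O$ (here contained in the open unit disc, so that $\Gamma$ is defined on it), and let $\mathfrak X$ be the set of $\mathcal C^1$ vector fields on $\mathcal U$. Put $\Sigma^+=\{(x,y)\in\mathcal U:y>0\}$, $\Sigma^-=\{(x,y)\in\mathcal U:y<0\}$, $\Sigma=\{(x,y)\in\mathcal U:y=0\}$ (the switching line). $\Omega$ is the set of piecewise smooth vector fields $Z=(X,Y)$, with $X=(X_1,X_2)$, $Y=(Y_1,Y_2)\in\mathfrak X$, given by $Z=X$ on $\Sigma^+$ and $Z=Y$ on $\Sigma^-$. On $\Sigma$, $Z$ is defined to be $Z_\Sigma$ by the Filippov convention. If $X\equiv Y$ on $\Sigma$, then $Z_\Sigma=X=Y$. Otherwise: on the crossing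 set $\Sigma^c=\{p\in\Sigma:X_2(p)Y_2(p)>0\}$, $Z_\Sigma=X$ if $X_2>0$ and $Z_\Sigma=Y$ if $X_2<0$ (orbits cross $\Sigma$ there); on the sliding set $\Sigma^s=\{p\in\Sigma:X_2(p)Y_2(p)\le0\}$, $Z_\Sigma=\left(\frac{Y_2X_1-X_2Y_1}{Y_2-X_2},0\right)$ if $X_2\ne Y_2$, and $Z_\Sigma=(0,0)$ if $X_2=Y_2=0$. Orbits of $Z$ are obtained by concatenating orbits of $X$ in $\Sigma^+$, $Y$ in $\Sigma^-$ and $Z_\Sigma$ in $\Sigma$. $\Omega_0\subset\Omega$ is the set of $Z=(X,Y)$ with $X(0,0)=Y(0,0)=(0,0)$, $\det A^+\det A^-\neq0$ and $X_{2x}(0,0)\,Y_{2x}(0,0)>0$, where $A^+$ (resp. $A^-$) is the Jacobian matrix of $X$ (resp. $Y$) at $O$ and the subscript $x$ denotes the partial derivative in $x$. The linear part of $Z$ is the piecewise linear vector field $(A^+(x,y)^\top,\ A^-(x,y)^\top)$. $Z_1,Z_2\in\Omega_0$ are locally $\Sigma$-equivalent near the origin if there exist neighborhoods $U,V$ of the origin and a homeomorphism $H:U\to V$ that maps the orbits of $Z_1$ in $U$ onto the orbits of $Z_2$ in $V$, preserving the direction of time, and sends $\Sigma\cap U$ to $\Sigma\cap V$. *)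

theory Defs
  imports "HOL-Analysis.Analysis"
begin

section \<open>Piecewise smooth vector fields\<close>

type_synonym vfield = "real^2 \<Rightarrow> real^2"

text \<open>Vector fields are total functions, but only their values on the domain \<open>\<U>\<close> are used.
  A pair \<open>(X, Y)\<close> stands for the field equal to \<open>X\<close> above and to \<open>Y\<close> below the line \<open>y = 0\<close>.\<close>

type_synonym pws = "vfield \<times> vfield"

definition Sigma_plus :: "(real^2) set \<Rightarrow> (real^2) set" where
  "Sigma_plus \<U> = {p \<in> \<U>. p $ 2 > 0}"

definition Sigma_minus :: "(real^2) set \<Rightarrow> (real^2) set" where
  "Sigma_minus \<U> = {p \<in> \<U>. p $ 2 < 0}"

definition Sigma_line :: "(real^2) set \<Rightarrow> (real^2) set" where
  "Sigma_line \<U> = {p \<in> \<U>. p $ 2 = 0}"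

definition C1_on :: "(real^2) set \<Rightarrow> vfield \<Rightarrow> bool" where
  "C1_on S F \<longleftrightarrow>
     (\<exists>F' :: real^2 \<Rightarrow> ((real^2) \<Rightarrow>\<^sub>L (real^2)).
        (\<forall>p\<in>S. (F has_derivative blinfun_apply (F' p)) (at p)) \<and> continuous_on S F')"

definition Omega :: "(real^2) set \<Rightarrow> pws set" where
  "Omega \<U> = {(X, Y). C1_on \<U> X \<and> C1_on \<U> Y}"

definition Omega0 :: "(real^2) set \<Rightarrow> pws set" where
  "Omega0 \<U> = {(X, Y) \<in> Omega \<U>.
     X 0 = 0 \<and> Y 0 = 0 \<and>
     det (jacobian X (at 0)) * det (jacobian Y (at 0)) \<noteq> 0 \<and>
     jacobian X (at 0) $ 2 $ 1 * jacobian Y (at 0) $ 2 $ 1 > 0}"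

definition linear_part :: "pws \<Rightarrow> pws" where
  "linear_part Z =
     ((\<lambda>p. jacobian (fst Z) (at 0) *v p), (\<lambda>p. jacobian (snd Z) (at 0) *v p))"

text \<open>The Filippov convention on the switching line.\<close>

definition Z_Sigma :: "(real^2) set \<Rightarrow> pws \<Rightarrow> vfield" where
  "Z_Sigma \<U> Z p =
    (let X = fst Z; Y = snd Z in
     if \<forall>q \<in> Sigma_line \<U>. X q = Y q then X p
     else if X p $ 2 * Y p $ 2 > 0 then (if X p $ 2 > 0 then X p else Y p)
     else if X p $ 2 \<noteq> Y p $ 2
       then vector [(Y p $ 2 * X p $ 1 - X p $ 2 * Y p $ 1) / (Y p $ 2 - X p $ 2), 0]
     else 0)"

section \<open>Orbits\<close>

text \<open>Near the parameter \<open>t\<close>, on the side described by the filter, \<open>\<gamma>\<close> is a single arc of an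
  orbit of \<open>X\<close> in the upper region, of \<open>Y\<close> in the lower region, or of the Filippov field in
  the switching line.\<close>

definition single_arc ::
    "(real^2) set \<Rightarrow> pws \<Rightarrow> (real \<Rightarrow> real^2) \<Rightarrow> real filter \<Rightarrow> bool" where
  "single_arc \<U> Z \<gamma> F \<longleftrightarrow>
     (\<forall>\<^sub>F s in F. \<gamma> s \<in> Sigma_plus \<U> \<and> (\<gamma> has_vector_derivative fst Z (\<gamma> s)) (at s)) \<or>
     (\<forall>\<^sub>F s in F. \<gamma> s \<in> Sigma_minus \<U> \<and> (\<gamma> has_vector_derivative snd Z (\<gamma> s)) (at s)) \<or>
     (\<forall>\<^sub>F s in F. \<gamma> s \<in> Sigma_line \<U> \<and> (\<gamma> has_vector_derivative Z_Sigma \<U> Z (\<gamma> s)) (at s))"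

text \<open>A trajectory in \<open>U\<close> is a continuous, locally finite concatenation of such arcs, parametrised
  by time over a nondegenerate interval. At an endpoint \<open>t\<close> of \<open>I\<close> one of the two filters is
  \<open>bot\<close>, so that the condition on that side is void.\<close>

definition trajectory ::
    "(real^2) set \<Rightarrow> pws \<Rightarrow> (real^2) set \<Rightarrow> (real \<Rightarrow> real^2) \<Rightarrow> real set \<Rightarrow> bool" where
  "trajectory \<U> Z U \<gamma> I \<longleftrightarrow>
     is_interval I \<and> interior I \<noteq> {} \<and> continuous_on I \<gamma> \<and> \<gamma> ` I \<subseteq> U \<and>
     (\<forall>t\<in>I. single_arc \<U> Z \<gamma> (at t within I \<inter> {t<..}) \<and>
            single_arc \<U> Z \<gamma> (at t within I \<inter> {..<t}))"

text \<open>The orbits of \<open>Z\<close> in \<open>U\<close> are the images \<open>\<gamma> ` I\<close> of maximal trajectories.\<close>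

definition maximal_trajectory ::
    "(real^2) set \<Rightarrow> pws \<Rightarrow> (real^2) set \<Rightarrow> (real \<Rightarrow> real^2) \<Rightarrow> real set \<Rightarrow> bool" where
  "maximal_trajectory \<U> Z U \<gamma> I \<longleftrightarrow>
     trajectory \<U> Z U \<gamma> I \<and>
     (\<forall>\<delta> J. trajectory \<U> Z U \<delta> J \<and> I \<subseteq> J \<and> (\<forall>t\<in>I. \<delta> t = \<gamma> t) \<longrightarrow> J = I)"

text \<open>\<open>H\<close> sends each orbit of \<open>Z\<close> in \<open>U\<close> onto an orbit of \<open>W\<close> in \<open>V\<close>, preserving the direction of
  time. A strictly increasing map of one interval onto another is automatically a
  homeomorphism, so \<open>\<tau>\<close> is an orientation-preserving change of parameter.\<close>

definition maps_orbits ::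
    "(real^2) set \<Rightarrow> pws \<Rightarrow> (real^2) set \<Rightarrow> pws \<Rightarrow> (real^2) set \<Rightarrow> vfield \<Rightarrow> bool" where
  "maps_orbits \<U> Z U W V H \<longleftrightarrow>
     (\<forall>\<gamma> I. maximal_trajectory \<U> Z U \<gamma> I \<longrightarrow>
        (\<exists>\<delta> J \<tau>. maximal_trajectory \<U> W V \<delta> J \<and>
           strict_mono_on I \<tau> \<and> \<tau> ` I = J \<and> (\<forall>t\<in>I. H (\<gamma> t) = \<delta> (\<tau> t))))"

text \<open>The condition on the inverse \<open>G\<close> says that every orbit of \<open>W\<close> in \<open>V\<close> is attained.\<close>

definition locally_Sigma_equivalent :: "(real^2) set \<Rightarrow> pws \<Rightarrow> pws \<Rightarrow> bool" where
  "locally_Sigma_equivalent \<U> Z W \<longleftrightarrow>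
     (\<exists>U V H G.
        open U \<and> 0 \<in> U \<and> U \<subseteq> \<U> \<and> open V \<and> 0 \<in> V \<and> V \<subseteq> \<U> \<and>
        homeomorphism U V H G \<and>
        maps_orbits \<U> Z U W V H \<and> maps_orbits \<U> W V Z U G \<and>
        H ` (Sigma_line \<U> \<inter> U) = Sigma_line \<U> \<inter> V)"

section \<open>The example\<close>

text \<open>The value outside the open unit disc is irrelevant.\<close>

definition Gam :: "real^2 \<Rightarrow> real" where
  "Gam p = (let r2 = (p $ 1)\<^sup>2 + (p $ 2)\<^sup>2 in
     if 0 < r2 \<and> r2 < 1 then r2 powr (1/2) * (- (1/2) * ln r2) powr (- (3/2)) else 0)"

definition X_star :: vfield where
  "X_star p = vector [p $ 2, p $ 1]"

definition Y_star :: vfield where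
  "Y_star p = vector [p $ 1 + 1/2 * Gam p, p $ 1 + p $ 2 + 1/2 * Gam p]"

definition XL_star :: vfield where
  "XL_star p = vector [p $ 2, p $ 1]"

definition YL_star :: vfield where
  "YL_star p = vector [p $ 1, p $ 1 + p $ 2]"

end

theory Submission
  imports Defs "HOL-Real_Asymp.Real_Asymp"
begin

text \<open>Below the switching line, \<open>YL_star\<close> has an improper node at the origin, so that some orbits of the
  linear part leave the origin there. The perturbation turns the node into a focus: writing
  \<open>w = - x / y\<close> and \<open>L = - ln r\<close>, an orbit of \<open>Y_star\<close> near the origin satisfies
  \<open>w' \<ge> w\<^sup>2 / 2 + L powr (- 3/2) / 4\<close> and \<open>L' \<ge> - 2\<close>. Since \<open>3/2 < 2\<close>, this
  inequality is oscillatory, and no orbit can stay in the lower half plane while \<open>L\<close> tends to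
  infinity backwards in time. Above the line, both fields are the same saddle, which has a single
  orbit leaving the origin, contained in the diagonal.

  An equivalence fixes the origin (the only constant orbit of the linear part), so its inverse maps
  the two eigenrays through \<open>(1, 1)\<close> and \<open>(0, -1)\<close>, which are orbits of the linear part leaving
  the origin off the switching line, to such orbits of \<open>(X_star, Y_star)\<close>. Both images lie on the
  diagonal and end at the origin, so they meet, contradicting injectivity.\<close>

section \<open>A Riccati inequality\<close>

lemma nonneg_deriv_le:
  fixes f :: "real \<Rightarrow> real"
  assumes "is_interval S" "\<And>t. t \<in> S \<Longrightarrow> (f has_real_derivative f' t) (at t)"
    and "\<And>t. t \<in> S \<Longrightarrow> 0 \<le> f' t" "s \<in> S" "t \<in> S" "s \<le> t"
  shows "f s \<le> f t"
proof (rule DERIV_nonneg_imp_nondecreasing[OF \<open>s \<le> t\<close>])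
  fix x assume "s \<le> x" "x \<le> t"
  then have "x \<in> S" using assms(1,4,5) by (meson mem_is_interval_1_I)
  then show "\<exists>y. (f has_real_derivative y) (at x) \<and> 0 \<le> y" using assms(2,3) by blast
qed

text \<open>This is applied with \<open>w\<close> the ratio \<open>- x / y\<close> and
  \<open>L\<close> the logarithmic distance to the origin. Going backwards, the quadratic term
  forces \<open>w\<close> to be of order at most 1 / L, the inhomogeneous term keeps it above 1 / (4
  sqrt L), and these are incompatible for large \<open>L\<close>. The hypothesis
  \<open>blowup\<close> covers both an infinite and a finite, unattained left end of
  \<open>S\<close>.\<close>

lemma riccati_no_backward_solution:
  fixes w L :: "real \<Rightarrow> real"
  assumes S: "is_interval S"
    and w: "\<And>t. t \<in> S \<Longrightarrow> (w has_real_derivative w' t) (at t)"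
    and L: "\<And>t. t \<in> S \<Longrightarrow> (L has_real_derivative L' t) (at t)"
    and Lpos: "\<And>t. t \<in> S \<Longrightarrow> 0 < L t"
    and w': "\<And>t. t \<in> S \<Longrightarrow> (w t)\<^sup>2 / 2 + 1 / (L t * sqrt (L t)) / 4 \<le> w' t"
    and L': "\<And>t. t \<in> S \<Longrightarrow> -2 \<le> L' t"
    and blowup: "\<And>M. \<exists>t1\<in>S. \<forall>t\<in>S. t \<le> t1 \<longrightarrow> M \<le> L t"
  shows False
proof -
  have far: "\<exists>t\<in>S. t \<le> t0 \<and> M \<le> L t" if "t0 \<in> S" for t0 M
  proof -
    obtain t1 where "t1 \<in> S" "\<forall>t\<in>S. t \<le> t1 \<longrightarrow> M \<le> L t" using blowup by blast
    then show ?thesis using that by (intro bexI[of _ "min t0 t1"]) (auto simp: min_def)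
  qed
  have w'_ge: "(w t)\<^sup>2 / 2 \<le> w' t" "1 / (L t * sqrt (L t)) / 4 \<le> w' t" "0 < w' t" if "t \<in> S" for t
  proof -
    have "0 < 1 / (L t * sqrt (L t)) / 4" using Lpos[OF that] by simp
    then show "(w t)\<^sup>2 / 2 \<le> w' t" "1 / (L t * sqrt (L t)) / 4 \<le> w' t" "0 < w' t"
      using w'[OF that] zero_le_power2[of "w t"] by linarith+
  qed
  have w_mono: "w s \<le> w t" if "s \<in> S" "t \<in> S" "s \<le> t" for s t
    using nonneg_deriv_le[OF S w _ that] w'_ge(3) by (simp add: less_imp_le)
  have w_strict: "w s < w t" if "s \<in> S" "t \<in> S" "s < t" for s t
  proof (rule DERIV_pos_imp_increasing[OF \<open>s < t\<close>])
    fix x assume "s \<le> x" "x \<le> t"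
    then have "x \<in> S" using S that by (meson mem_is_interval_1_I)
    then show "\<exists>y. (w has_real_derivative y) (at x) \<and> 0 < y" using w w'_ge(3) by blast
  qed
  \<comment> \<open>Since \<open>(1 / w)' \<le> - 1 / 2\<close> and \<open>L' \<ge> - 2\<close>, the function \<open>1 / w - L / 4\<close> is nonincreasing. Hence
     \<open>w\<close> cannot be negative, and it is \<open>O(1 / L)\<close>, whereas integrating the other term of the
     inequality bounds it below by a multiple of \<open>1 / sqrt L\<close>.\<close>
  have recip: "L t / 4 + (1 / w t1 - L t1 / 4) \<le> 1 / w t"
    if "t1 \<in> S" "t \<in> S" "t \<le> t1" "\<And>t. t \<in> S \<Longrightarrow> t \<le> t1 \<Longrightarrow> w t \<noteq> 0" for t1 t
  proof -
    have "L t / 4 - 1 / w t \<le> L t1 / 4 - 1 / w t1"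
    proof (rule nonneg_deriv_le[of "S \<inter> {..t1}" "\<lambda>t. L t / 4 - 1 / w t"
              "\<lambda>t. L' t / 4 + w' t / (w t)\<^sup>2"])
      show "is_interval (S \<inter> {..t1})" using S by (simp add: is_interval_Int)
      fix u assume u: "u \<in> S \<inter> {..t1}"
      then have nz: "w u \<noteq> 0" using that(4) by simp
      show "((\<lambda>t. L t / 4 - 1 / w t) has_real_derivative L' u / 4 + w' u / (w u)\<^sup>2) (at u)"
        using u nz by (auto intro!: derivative_eq_intros L w simp: power2_eq_square)
      have "1 / 2 \<le> w' u / (w u)\<^sup>2" using w'_ge(1)[of u] u nz by (simp add: pos_le_divide_eq)
      then show "0 \<le> L' u / 4 + w' u / (w u)\<^sup>2" using L'[of u] u by simp
    qed (use that in auto)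
    then show ?thesis by simp
  qed
  have wpos: "0 < w t0" if t0: "t0 \<in> S" for t0
  proof (rule ccontr)
    assume "\<not> 0 < w t0"
    \<comment> \<open>The increase of \<open>L\<close> by 1 forces \<open>t1\<close> to differ from
      \<open>t0\<close>, so strict monotonicity gives \<open>w t1 < 0\<close> even if
      \<open>w t0 = 0\<close>.\<close>
    moreover obtain t1 where t1: "t1 \<in> S" "t1 \<le> t0" "L t0 + 1 \<le> L t1" using far[OF t0] by blast
    moreover have "t1 < t0" using t1 by (cases "t1 = t0") auto
    ultimately have neg: "w t < 0" if "t \<in> S" "t \<le> t1" for t
      using w_mono[of t t1] w_strict[of t1 t0] that \<open>t0 \<in> S\<close> by auto
    define K where "K = 1 / w t1 - L t1 / 4"
    obtain t where t: "t \<in> S" "t \<le> t1" "- 4 * K \<le> L t"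
      using far[OF t1(1)] by blast
    have "L t / 4 + K \<le> 1 / w t"
      unfolding K_def by (rule recip[OF t1(1) t(1,2)]) (use neg in force)
    then have "0 \<le> 1 / w t" using t(3) by linarith
    then show False using neg[OF t(1,2)] by (simp add: zero_le_divide_iff)
  qed
  have lower: "1 / (4 * sqrt (L t)) \<le> w t" if t: "t \<in> S" for t
  proof (rule ccontr)
    \<comment> \<open>The derivative of w - 1 / (4 sqrt L) is w' + L' / (8 L^(3/2)), which is at
      least 1 / (4 L^(3/2)) - 2 / (8 L^(3/2)) = 0. A value - e < 0 at \<open>t\<close> would persist
      backwards, while \<open>w\<close> is positive and 1 / (4 sqrt L) falls to \<open>e\<close> or
      below.\<close>
    define e where "e = 1 / (4 * sqrt (L t)) - w t"
    assume "\<not> ?thesis"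
    then have "e > 0" by (simp add: e_def)
    obtain s where s: "s \<in> S" "s \<le> t" "(1 / (4 * e))\<^sup>2 \<le> L s" using far[OF t] by blast
    have "w s - 1 / (4 * sqrt (L s)) \<le> w t - 1 / (4 * sqrt (L t))"
    proof (rule nonneg_deriv_le[of S "\<lambda>t. w t - 1 / (4 * sqrt (L t))"
              "\<lambda>t. w' t + L' t / (8 * L t * sqrt (L t))"])
      fix u assume u: "u \<in> S"
      have sq: "sqrt (L u) * sqrt (L u) = L u" using Lpos[OF u] by simp
      show "((\<lambda>t. w t - 1 / (4 * sqrt (L t))) has_real_derivative
              w' u + L' u / (8 * L u * sqrt (L u))) (at u)"
        using u Lpos[OF u] sq
        by (auto intro!: derivative_eq_intros L w simp: field_simps)
      have "- 2 / (8 * L u * sqrt (L u)) \<le> L' u / (8 * L u * sqrt (L u))"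
        using L'[OF u] Lpos[OF u] by (intro divide_right_mono) auto
      then show "0 \<le> w' u + L' u / (8 * L u * sqrt (L u))" using w'_ge(2)[OF u] by simp
    qed (use S s t in auto)
    moreover have "1 / (4 * e) \<le> sqrt (L s)" using s(3) by (simp add: real_le_rsqrt)
    then have "1 / (4 * sqrt (L s)) \<le> e" using \<open>e > 0\<close> Lpos[OF s(1)] by (simp add: field_simps)
    ultimately show False using wpos[OF s(1)] by (simp add: e_def)
  qed
  obtain t1 where t1: "t1 \<in> S" using blowup by blast
  define K where "K = 1 / w t1 - L t1 / 4"
  \<comment> \<open>The bound - 8 K lets half of L / 4 absorb \<open>K\<close>. The two bounds on
    \<open>w\<close> then give sqrt L / 4 <= w L <= 8, so L <= 1024, which 2000 exceeds.\<close>
  obtain t where t: "t \<in> S" "t \<le> t1" "max (- 8 * K) 2000 \<le> L t" using far[OF t1] by blast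
  have "L t / 8 \<le> L t / 4 + K" using t(3) by simp
  also have "\<dots> \<le> 1 / w t"
    unfolding K_def by (rule recip[OF t1 t(1,2)]) (use wpos in force)
  finally have "w t * L t \<le> 8" using wpos[OF t(1)] by (simp add: field_simps)
  moreover have "1 / (4 * sqrt (L t)) * L t \<le> w t * L t"
    using lower[OF t(1)] Lpos[OF t(1)] by (intro mult_right_mono) auto
  moreover have "1 / (4 * sqrt (L t)) * L t = sqrt (L t) / 4"
    using real_div_sqrt[of "L t"] Lpos[OF t(1)] by (simp add: field_simps)
  ultimately have "sqrt (L t) \<le> 32" by linarith
  moreover have "sqrt (2000) \<le> sqrt (L t)" using t(3) by simp
  moreover have "sqrt 2000 > 32" by (rule real_less_rsqrt) simp
  ultimately show False by linarith
qed

section \<open>Derivatives along trajectories\<close>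

text \<open>A junction of two arcs of the same continuous field is not a corner: by the fundamental
  theorem of calculus with the exceptional point \<open>t\<close>, \<gamma> is an integral of the
  continuous function F o \<gamma>, hence differentiable at \<open>t\<close> as well.\<close>

lemma has_vector_derivative_punctured:
  fixes \<gamma> :: "real \<Rightarrow> 'a::banach"
  assumes J: "open J" "t \<in> J" and cont: "continuous_on J \<gamma>" and F: "continuous_on (\<gamma> ` J) F"
    and left: "\<forall>\<^sub>F s in at_left t. (\<gamma> has_vector_derivative F (\<gamma> s)) (at s)"
    and right: "\<forall>\<^sub>F s in at_right t. (\<gamma> has_vector_derivative F (\<gamma> s)) (at s)"
  shows "(\<gamma> has_vector_derivative F (\<gamma> t)) (at t)"
proof -
  have "\<forall>\<^sub>F s in at t. (\<gamma> has_vector_derivative F (\<gamma> s)) (at s)"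
    using left right by (simp add: eventually_at_split)
  then obtain d where d: "d > 0" "\<And>s. s \<noteq> t \<Longrightarrow> dist s t < d \<Longrightarrow> (\<gamma> has_vector_derivative F (\<gamma> s)) (at s)"
    by (auto simp: eventually_at)
  obtain e where e: "e > 0" "ball t e \<subseteq> J" using J openE by blast
  define h where "h = min d e / 2"
  have h: "h > 0" "h < d" "h < e" using d e by (auto simp: h_def)
  define a b where "a = t - h" and "b = t + h"
  have sub: "{a..b} \<subseteq> J"
    using h by (intro order_trans[OF _ e(2)]) (auto simp: a_def b_def dist_real_def)
  have FTC: "((\<lambda>s. F (\<gamma> s)) has_integral (\<gamma> u - \<gamma> a)) {a..u}" if "u \<in> {a..b}" for u
  proof (rule fundamental_theorem_of_calculus_interior_strong[of "{t}"])
    show "continuous_on {a..u} \<gamma>" using that by (intro continuous_on_subset[OF cont] order_trans[OF _ sub]) auto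
    fix s assume "s \<in> {a<..<u} - {t}"
    then show "(\<gamma> has_vector_derivative F (\<gamma> s)) (at s)" using that h
      by (intro d(2)) (auto simp: a_def b_def dist_real_def)
  qed (use that in auto)
  have cF: "continuous_on {a..b} (\<lambda>s. F (\<gamma> s))"
    using sub by (intro continuous_on_compose2[OF F continuous_on_subset[OF cont sub]]) auto
  have tab: "t \<in> {a..b}" "t \<in> {a<..<b}" using h by (auto simp: a_def b_def)
  have "((\<lambda>u. integral {a..u} (\<lambda>s. F (\<gamma> s)) + \<gamma> a) has_vector_derivative F (\<gamma> t)) (at t within {a..b})"
    by (rule integral_has_vector_derivative[OF cF tab(1), THEN has_vector_derivative_add_const[THEN iffD2]])
  then have "(\<gamma> has_vector_derivative F (\<gamma> t)) (at t within {a..b})"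
    by (rule has_vector_derivative_transform[OF tab(1), rotated])
       (simp add: integral_unique[OF FTC])
  then show ?thesis using tab(2)
    by (metis at_within_interior interior_atLeastAtMost_real)
qed

lemma at_within_open_Int:
  fixes t :: real
  assumes "open J" "t \<in> J"
  shows "at t within J \<inter> A = at t within A"
  by (rule at_within_nhd[of t J]) (use assms in auto)

text \<open>A trajectory staying strictly on one side is a classical solution there: the sign
  excludes the other two kinds of arc, and the previous lemma supplies the derivative at the
  junctions.\<close>

lemma trajectory_side_derivative:
  assumes tr: "trajectory \<U> Z U \<gamma> J" and J: "open J" "t \<in> J"
  shows "(\<And>s. s \<in> J \<Longrightarrow> \<gamma> s $ 2 > 0) \<Longrightarrow> continuous_on (\<gamma> ` J) (fst Z) \<Longrightarrow>
      (\<gamma> has_vector_derivative fst Z (\<gamma> t)) (at t)"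
    and "(\<And>s. s \<in> J \<Longrightarrow> \<gamma> s $ 2 < 0) \<Longrightarrow> continuous_on (\<gamma> ` J) (snd Z) \<Longrightarrow>
      (\<gamma> has_vector_derivative snd Z (\<gamma> t)) (at t)"
proof -
  have inJ: "\<forall>\<^sub>F s in at_right t. s \<in> J" "\<forall>\<^sub>F s in at_left t. s \<in> J"
    using J by (auto intro: eventually_at_in_open' filter_leD[OF at_le] simp: eventually_at_split)
  have cont: "continuous_on J \<gamma>" using tr by (simp add: trajectory_def)
  have arcs: "single_arc \<U> Z \<gamma> (at_right t)" "single_arc \<U> Z \<gamma> (at_left t)"
    using tr J by (auto simp: trajectory_def at_within_open_Int)
  have up: "\<forall>\<^sub>F s in G. (\<gamma> has_vector_derivative fst Z (\<gamma> s)) (at s)"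
    if arc: "single_arc \<U> Z \<gamma> G" and G: "\<forall>\<^sub>F s in G. s \<in> J" and side: "\<And>s. s \<in> J \<Longrightarrow> \<gamma> s $ 2 > 0" for G
  proof -
    have *: ?thesis if "\<forall>\<^sub>F s in G. \<gamma> s \<in> A \<and> P s" "\<And>s. s \<in> J \<Longrightarrow> \<gamma> s \<notin> A" for A P
      using G that(1) by eventually_elim (use that(2) in blast)
    show ?thesis
      using arc side unfolding single_arc_def
      by (elim disjE) (fastforce intro: * elim: eventually_mono simp: Sigma_plus_def Sigma_minus_def Sigma_line_def)+
  qed
  have down: "\<forall>\<^sub>F s in G. (\<gamma> has_vector_derivative snd Z (\<gamma> s)) (at s)"
    if arc: "single_arc \<U> Z \<gamma> G" and G: "\<forall>\<^sub>F s in G. s \<in> J" and side: "\<And>s. s \<in> J \<Longrightarrow> \<gamma> s $ 2 < 0" for G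
  proof -
    have *: ?thesis if "\<forall>\<^sub>F s in G. \<gamma> s \<in> A \<and> P s" "\<And>s. s \<in> J \<Longrightarrow> \<gamma> s \<notin> A" for A P
      using G that(1) by eventually_elim (use that(2) in blast)
    show ?thesis
      using arc side unfolding single_arc_def
      by (elim disjE) (fastforce intro: * elim: eventually_mono simp: Sigma_plus_def Sigma_minus_def Sigma_line_def)+
  qed
  show "(\<gamma> has_vector_derivative fst Z (\<gamma> t)) (at t)"
    if "\<And>s. s \<in> J \<Longrightarrow> \<gamma> s $ 2 > 0" "continuous_on (\<gamma> ` J) (fst Z)"
    by (rule has_vector_derivative_punctured[OF J cont that(2) up up])
       (use arcs inJ that in auto)
  show "(\<gamma> has_vector_derivative snd Z (\<gamma> t)) (at t)"
    if "\<And>s. s \<in> J \<Longrightarrow> \<gamma> s $ 2 < 0" "continuous_on (\<gamma> ` J) (snd Z)"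
    by (rule has_vector_derivative_punctured[OF J cont that(2) down down])
       (use arcs inJ that in auto)
qed

section \<open>The function \<open>Gam\<close> and the linear part\<close>

lemma norm_real2: "norm (p :: real^2) = sqrt ((p $ 1)\<^sup>2 + (p $ 2)\<^sup>2)"
  by (simp add: norm_vec_def L2_set_def sum_2)

definition logr :: "real^2 \<Rightarrow> real" where "logr p = - ln (norm p)"

lemma Gam_eq:
  assumes "norm p < 1"
  shows "Gam p = norm p / (logr p * sqrt (logr p))"
proof (cases "p = 0")
  case False
  define r where "r = norm p"
  have r: "0 < r" "r < 1" using False assms by (auto simp: r_def)
  have r2: "(p $ 1)\<^sup>2 + (p $ 2)\<^sup>2 = r\<^sup>2" by (simp add: r_def norm_real2)
  have L: "- (1/2) * ln (r\<^sup>2) = logr p" "0 < logr p"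
    using r False assms by (auto simp: ln_realpow logr_def r_def)
  have "logr p powr (- (3/2)) = logr p powr (- (1 + 1/2))" by simp
  also have "\<dots> = inverse (logr p powr (1 + 1/2))" by (rule powr_minus)
  also have "\<dots> = 1 / (logr p * sqrt (logr p))"
    using L(2) by (simp only: powr_add powr_half_sqrt) (simp add: divide_inverse)
  finally have "logr p powr (- (3/2)) = 1 / (logr p * sqrt (logr p))" .
  moreover have "r\<^sup>2 < 1" using r by (simp add: power_less_one_iff)
  ultimately show ?thesis
    using r L(1) unfolding Gam_def r2 by (simp add: powr_half_sqrt r_def[symmetric])
qed (simp add: Gam_def)

text \<open>This is the derivative of r L^(-3/2) with L = - ln r, namely L^(-3/2) + (3/2)
  L^(-5/2).\<close>

definition Gam_slope :: "real \<Rightarrow> real" where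
  "Gam_slope r = 1 / (- ln r * sqrt (- ln r)) + 3 / (2 * (ln r)\<^sup>2 * sqrt (- ln r))"

text \<open>Since \<open>sgn 0 = 0\<close>, the formula also yields the correct gradient 0 at the
  origin, so it serves on the whole disc.\<close>

definition Gam_grad :: "real^2 \<Rightarrow> real^2" where
  "Gam_grad p = Gam_slope (norm p) *\<^sub>R sgn p"

lemma radial_profile_derivative:
  assumes "0 < r" "r < 1"
  shows "((\<lambda>r. r / (- ln r * sqrt (- ln r))) has_real_derivative Gam_slope r) (at r)"
proof -
  have L: "- ln r > 0" using assms by simp
  define q where "q = sqrt (- ln r)"
  have q: "q > 0" "ln r = - (q * q)" using L by (auto simp: q_def)
  show ?thesis
    by (rule derivative_eq_intros refl | use assms L in force)+
       (use assms q in \<open>simp add: Gam_slope_def q_def[symmetric] field_simps power2_eq_square\<close>)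
qed

text \<open>Reduces limits of radial functions at the origin to one-variable asymptotics.\<close>

lemma filterlim_norm_at_right: "filterlim norm (at_right 0) (at (0::'a::real_normed_vector))"
  by (rule filterlim_at_withinI) (auto simp: eventually_at_filter intro!: tendsto_eq_intros)

text \<open>Off the origin this is the chain rule for the radial profile. At the origin Gam p / norm
  p = L^(-3/2) tends to 0, so the perturbation is of smaller than linear order.\<close>

lemma Gam_has_derivative:
  assumes "norm p < 1"
  shows "(Gam has_derivative (\<lambda>h. Gam_grad p \<bullet> h)) (at p)"
proof -
  have ev: "\<forall>\<^sub>F q in nhds p. Gam q = norm q / (- ln (norm q) * sqrt (- ln (norm q)))"
    by (rule eventually_mono[OF eventually_nhds_in_open[of "ball 0 1"]])
       (use assms Gam_eq in \<open>auto simp: logr_def\<close>)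
  show ?thesis
  proof (cases "p = 0")
    case False
    have "((\<lambda>q. norm q / (- ln (norm q) * sqrt (- ln (norm q)))) has_derivative
            (\<lambda>h. Gam_slope (norm p) * (sgn p \<bullet> h))) (at p)"
      using has_derivative_compose[OF has_derivative_norm[of p]
         radial_profile_derivative[unfolded has_field_derivative_def]] False assms
      by (simp add: inner_commute)
    then have "(Gam has_derivative (\<lambda>h. Gam_slope (norm p) * (sgn p \<bullet> h))) (at p)"
      by (rule has_derivative_transform_within_open[of _ _ p UNIV "ball 0 1"])
         (use assms in \<open>auto simp: Gam_eq logr_def\<close>)
    then show ?thesis by (simp add: Gam_grad_def)
  next
    case True
    have "((\<lambda>r::real. 1 / (- ln r * sqrt (- ln r))) \<longlongrightarrow> 0) (at_right 0)" by real_asymp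
    from filterlim_compose[OF this filterlim_norm_at_right]
    have lim: "((\<lambda>h::real^2. 1 / (- ln (norm h) * sqrt (- ln (norm h)))) \<longlongrightarrow> 0) (at 0)" .
    have "((\<lambda>h. norm (Gam h) / norm h) \<longlongrightarrow> 0) (at 0)"
    proof (rule Lim_transform_eventually[OF tendsto_norm_zero[OF lim]])
      show "\<forall>\<^sub>F h in at 0. norm (1 / (- ln (norm h) * sqrt (- ln (norm h)))) = norm (Gam h) / norm h"
        using ev[unfolded True eventually_nhds_conv_at] eventually_neq_at_within[of 0 0 UNIV]
        by (auto elim!: eventually_elim2 simp: abs_mult)
    qed
    then show ?thesis
      using True by (simp add: has_derivative_at Gam_grad_def Gam_def)
  qed
qed

lemma continuous_on_Gam_grad: "continuous_on (ball 0 1) Gam_grad"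
proof (rule continuous_at_imp_continuous_on, rule ballI)
  fix p :: "real^2" assume "p \<in> ball 0 1"
  show "isCont Gam_grad p"
  proof (cases "p = 0")
    case False
    then have "ln (norm p) < 0" using \<open>p \<in> ball 0 1\<close> by simp
    then show ?thesis using False
      unfolding Gam_grad_def[abs_def] Gam_slope_def sgn_div_norm
      by (intro continuous_intros) auto
  next
    case True
    have "(Gam_slope \<longlongrightarrow> 0) (at_right 0)" unfolding Gam_slope_def[abs_def] by real_asymp
    from filterlim_compose[OF this filterlim_norm_at_right]
    have "((\<lambda>h::real^2. Gam_slope (norm h)) \<longlongrightarrow> 0) (at 0)" .
    then have "(Gam_grad \<longlongrightarrow> 0) (at 0)"
      by (rule tendsto_rabs_zero[THEN tendsto_0_le[where K=1]])
         (auto intro!: always_eventually simp: Gam_grad_def norm_sgn)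
    then show ?thesis using True by (simp add: isCont_def Gam_grad_def)
  qed
qed

lemma linear_YL_star: "linear YL_star"
  by (rule linearI) (auto simp: YL_star_def vec_eq_iff forall_2 algebra_simps)

lemma linear_XL_star: "linear XL_star"
  by (rule linearI) (auto simp: XL_star_def vec_eq_iff forall_2)

lemma X_star_eq: "X_star = XL_star"
  by (auto simp: X_star_def XL_star_def)

lemma Y_star_eq: "Y_star p = YL_star p + (Gam p / 2) *\<^sub>R vector [1, 1]"
  by (auto simp: Y_star_def YL_star_def vec_eq_iff forall_2)

lemma Y_star_has_derivative:
  assumes "norm p < 1"
  shows "(Y_star has_derivative (\<lambda>h. YL_star h + (Gam_grad p \<bullet> h / 2) *\<^sub>R vector [1, 1])) (at p)"
  unfolding Y_star_eq[abs_def]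
  by (intro derivative_intros linear_imp_has_derivative linear_YL_star
      has_derivative_divide[OF Gam_has_derivative[OF assms] has_derivative_const, of 2, simplified])

lemma C1_X_star: "C1_on S X_star"
  unfolding C1_on_def X_star_eq
  by (rule exI[of _ "\<lambda>_. Blinfun XL_star"])
     (auto simp: bounded_linear_Blinfun_apply linear_XL_star linear_linear
        intro: linear_imp_has_derivative)

lemma C1_Y_star:
  assumes "S \<subseteq> ball 0 1"
  shows "C1_on S Y_star"
  unfolding C1_on_def
proof (intro exI conjI ballI)
  let ?F = "\<lambda>p. Blinfun YL_star +
       (1/2) *\<^sub>R (blinfun_scaleR_left (vector [1, 1]) o\<^sub>L blinfun_inner_right (Gam_grad p))"
  show "continuous_on S ?F"
    by (intro continuous_intros bounded_linear.continuous_on[OF bounded_linear_blinfun_inner_right]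
          continuous_on_subset[OF continuous_on_Gam_grad assms])
  fix p assume "p \<in> S"
  then have "norm p < 1" using assms by auto
  moreover have "blinfun_apply (?F p) = (\<lambda>h. YL_star h + (Gam_grad p \<bullet> h / 2) *\<^sub>R vector [1, 1])"
    by (auto simp: fun_eq_iff blinfun.bilinear_simps bounded_linear_Blinfun_apply linear_YL_star linear_linear)
  ultimately show "(Y_star has_derivative blinfun_apply (?F p)) (at p)"
    using Y_star_has_derivative by simp
qed

section \<open>Jacobians at the origin and membership in \<open>Omega0\<close>\<close>

lemma jacobian_XL_star: "jacobian XL_star (at 0) = matrix XL_star"
  by (simp add: jacobian_def
      frechet_derivative_at[OF linear_imp_has_derivative[OF linear_XL_star], symmetric])

lemma jacobian_Y_star: "jacobian Y_star (at 0) = matrix YL_star"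
proof -
  have "(Y_star has_derivative YL_star) (at 0)"
    using Y_star_has_derivative[of 0] by (simp add: Gam_grad_def)
  then show ?thesis by (simp add: jacobian_def frechet_derivative_at[symmetric])
qed

lemma X_star_Y_star_in_Omega0:
  assumes "\<U> \<subseteq> ball 0 1"
  shows "(X_star, Y_star) \<in> Omega0 \<U>"
  using C1_X_star C1_Y_star[OF assms]
  by (auto simp: Omega0_def Omega_def jacobian_XL_star X_star_eq jacobian_Y_star X_star_eq Y_star_eq Gam_def
      matrix_def XL_star_def YL_star_def det_2 axis_def vec_eq_iff forall_2)

lemma linear_part_star: "linear_part (X_star, Y_star) = (XL_star, YL_star)"
  by (simp add: linear_part_def jacobian_XL_star X_star_eq jacobian_Y_star
      matrix_works linear_XL_star linear_YL_star)

section \<open>Trajectories leaving the origin\<close>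

text \<open>The right-hand side of the first bound is the time derivative of w = - x / y along
  \<open>Y_star\<close>. The linear field alone gives w' = w^2; half of this is spent on absorbing
  the part of the perturbation with the wrong sign. The second bound says r r' <= 2 r^2, that is, L'
  >= - 2 for L = - ln r.\<close>

lemma Y_star_polar_estimates:
  assumes y: "p $ 2 < 0" and "norm p < 1" and L: "4 \<le> logr p"
  shows "(- (p $ 1) / p $ 2)\<^sup>2 / 2 + 1 / (logr p * sqrt (logr p)) / 4
           \<le> (p $ 1 * Y_star p $ 2 - p $ 2 * Y_star p $ 1) / (p $ 2)\<^sup>2"
    and "p $ 1 * Y_star p $ 1 + p $ 2 * Y_star p $ 2 \<le> 2 * ((p $ 1)\<^sup>2 + (p $ 2)\<^sup>2)"
proof -
  define x b r E where "x = p $ 1" and "b = - (p $ 2)" and "r = norm p"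
    and "E = 1 / (logr p * sqrt (logr p))"
  have b: "b > 0" using y by (simp add: b_def)
  have "2 \<le> sqrt (logr p)" using L by (intro real_le_rsqrt) simp
  then have "4 * 2 \<le> logr p * sqrt (logr p)" using L by (intro mult_mono) auto
  then have E: "0 \<le> E" "E \<le> 1 / 8" by (auto simp: E_def field_simps)
  have Gam: "Gam p = r * E" using Gam_eq[OF assms(2)] by (simp add: r_def E_def)
  have r: "r\<^sup>2 = x\<^sup>2 + b\<^sup>2" "0 \<le> r" by (auto simp: r_def norm_real2 x_def b_def)
  have r_bounds: "b \<le> r" "\<bar>x\<bar> \<le> r" "r \<le> \<bar>x\<bar> + b"
    using r b by (auto intro: power2_le_imp_le abs_le_square_iff[THEN iffD2] simp: power2_sum
        intro!: power2_le_imp_le[of r "\<bar>x\<bar> + b"])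
  \<comment> \<open>This is the first bound multiplied by b^2. If x >= - b / 2, then r >= b and x +
    b >= b / 2 make the bracket nonnegative. Otherwise b and r are at most 2 |x| and 3 |x|, the
    bracket is at least - (5/2) x^2, and E <= 1/8 leaves a loss of at most 5/16 x^2.\<close>
  have key: "0 \<le> x\<^sup>2 / 2 + E * (r * (x + b) / 2 - b\<^sup>2 / 4)"
  proof (cases "- b / 2 \<le> x")
    case True
    then have "b * (b / 2) \<le> r * (x + b)" using r_bounds b by (intro mult_mono) auto
    then show ?thesis using E by (simp add: power2_eq_square)
  next
    case False
    then have xb: "b \<le> 2 * \<bar>x\<bar>" "\<bar>x\<bar> = - x" using b by auto
    have "r * (- x) \<le> (3 * \<bar>x\<bar>) * \<bar>x\<bar>" using r_bounds xb by (intro mult_mono) auto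
    moreover have "0 \<le> r * b" using r b by simp
    moreover have "b * b \<le> (2 * \<bar>x\<bar>) * (2 * \<bar>x\<bar>)" using xb b by (intro mult_mono) auto
    ultimately have "- (5 / 2 * x\<^sup>2) \<le> r * (x + b) / 2 - b\<^sup>2 / 4"
      by (simp add: power2_eq_square algebra_simps)
    then have "E * - (5 / 2 * x\<^sup>2) \<le> E * (r * (x + b) / 2 - b\<^sup>2 / 4)"
      using E by (intro mult_left_mono)
    moreover have "E * (5 / 2 * x\<^sup>2) \<le> 1 / 8 * (5 / 2 * x\<^sup>2)"
      using E by (intro mult_right_mono) auto
    moreover have "0 \<le> x\<^sup>2" by simp
    ultimately show ?thesis by linarith
  qed
  have "(x\<^sup>2 / 2 + E * b\<^sup>2 / 4) / b\<^sup>2 \<le> (x\<^sup>2 + r * E * (x + b) / 2) / b\<^sup>2"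
  proof (rule divide_right_mono)
    have "x\<^sup>2 + r * E * (x + b) / 2 - (x\<^sup>2 / 2 + E * b\<^sup>2 / 4)
        = x\<^sup>2 / 2 + E * (r * (x + b) / 2 - b\<^sup>2 / 4)"
      by (simp add: field_simps)
    then show "x\<^sup>2 / 2 + E * b\<^sup>2 / 4 \<le> x\<^sup>2 + r * E * (x + b) / 2" using key by linarith
  qed simp
  moreover have "(x\<^sup>2 / 2 + E * b\<^sup>2 / 4) / b\<^sup>2 = (x / b)\<^sup>2 / 2 + E / 4"
    using b by (simp add: field_simps power2_eq_square)
  moreover have "p $ 1 * Y_star p $ 2 - p $ 2 * Y_star p $ 1 = x\<^sup>2 + r * E * (x + b) / 2"
    by (simp add: Y_star_def Gam x_def b_def power2_eq_square algebra_simps diff_divide_distrib)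
  ultimately show "(- (p $ 1) / p $ 2)\<^sup>2 / 2 + 1 / (logr p * sqrt (logr p)) / 4
           \<le> (p $ 1 * Y_star p $ 2 - p $ 2 * Y_star p $ 1) / (p $ 2)\<^sup>2"
    by (simp add: x_def b_def E_def)
  \<comment> \<open>The perturbation contributes at most r^2 / 16 and the mixed term - x b at most
    r^2 / 2, so the total is at most (25/16) r^2.\<close>
  have "r * (x - b) \<le> r * r" using r r_bounds b by (intro mult_left_mono) auto
  then have "E * (r * (x - b)) \<le> E * (r * r)" using E(1) by (rule mult_left_mono)
  also have "\<dots> \<le> 1 / 8 * (r * r)" using E by (intro mult_right_mono) auto
  finally have 1: "E * (r * (x - b)) \<le> r\<^sup>2 / 8" by (simp add: power2_eq_square)
  have "0 \<le> (x + b)\<^sup>2" by simp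
  then have 2: "- (x * b) \<le> r\<^sup>2 / 2" unfolding r by (simp add: power2_sum)
  have "p $ 1 * Y_star p $ 1 + p $ 2 * Y_star p $ 2 = x\<^sup>2 + b\<^sup>2 - x * b + E * (r * (x - b)) / 2"
    by (simp add: Y_star_def Gam x_def b_def power2_eq_square field_simps)
  also have "\<dots> \<le> 2 * (x\<^sup>2 + b\<^sup>2)"
    using 1 2 zero_le_power2[of r] unfolding r(1)[symmetric] by linarith
  finally show "p $ 1 * Y_star p $ 1 + p $ 2 * Y_star p $ 2 \<le> 2 * ((p $ 1)\<^sup>2 + (p $ 2)\<^sup>2)"
    by (simp add: x_def b_def)
qed

lemma has_real_derivative_vec_nth:
  assumes "(\<gamma> has_vector_derivative v) F"
  shows "((\<lambda>t. \<gamma> t $ i) has_real_derivative v $ i) F"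
  using bounded_linear.has_vector_derivative[OF bounded_linear_vec_nth assms]
  by (simp add: has_real_derivative_iff_has_vector_derivative)

text \<open>On an initial piece of \<open>J\<close> where \<open>norm\<close> is below exp (- 4),
  the polar estimates put \<open>w\<close> and \<open>L\<close> under the Riccati lemma. The
  hypothesis \<open>lim\<close> expresses convergence to the origin at the left end of
  \<open>J\<close>, be it finite or not.\<close>

lemma Y_star_no_backward_limit:
  assumes J: "is_interval J"
    and der: "\<And>t. t \<in> J \<Longrightarrow> (\<gamma> has_vector_derivative Y_star (\<gamma> t)) (at t)"
    and low: "\<And>t. t \<in> J \<Longrightarrow> \<gamma> t $ 2 < 0"
    and lim: "\<And>e. 0 < e \<Longrightarrow> \<exists>t1\<in>J. \<forall>t\<in>J. t \<le> t1 \<longrightarrow> norm (\<gamma> t) < e"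
  shows False
proof -
  have nz: "\<gamma> t \<noteq> 0" if "t \<in> J" for t using low[OF that] by auto
  have logr_large: "M \<le> logr (\<gamma> t)" if "t \<in> J" "norm (\<gamma> t) < exp (- M)" for t M
    using that nz[OF that(1)] unfolding logr_def
    by (metis less_imp_le ln_exp ln_mono minus_le_iff neg_le_iff_le zero_less_norm_iff minus_minus)
  obtain t0 where t0: "t0 \<in> J" "\<forall>t\<in>J. t \<le> t0 \<longrightarrow> norm (\<gamma> t) < exp (- 4)"
    using lim[of "exp (- 4)"] by auto
  define S where "S = J \<inter> {..t0}"
  have S: "t \<in> J" "norm (\<gamma> t) < 1" "4 \<le> logr (\<gamma> t)" if "t \<in> S" for t
  proof -
    show "t \<in> J" using that by (simp add: S_def)
    have "norm (\<gamma> t) < exp (- 4)" using t0 that by (auto simp: S_def)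
    then show "norm (\<gamma> t) < 1" "4 \<le> logr (\<gamma> t)"
      using logr_large \<open>t \<in> J\<close> by (auto intro: less_trans)
  qed
  note comp = has_real_derivative_vec_nth[OF der[OF S(1)]]
  let ?w' = "\<lambda>t. (\<gamma> t $ 1 * Y_star (\<gamma> t) $ 2 - \<gamma> t $ 2 * Y_star (\<gamma> t) $ 1) / (\<gamma> t $ 2)\<^sup>2"
  let ?L' = "\<lambda>t. - (\<gamma> t $ 1 * Y_star (\<gamma> t) $ 1 + \<gamma> t $ 2 * Y_star (\<gamma> t) $ 2) /
                ((\<gamma> t $ 1)\<^sup>2 + (\<gamma> t $ 2)\<^sup>2)"
  have sq_pos: "0 < (\<gamma> t $ 1)\<^sup>2 + (\<gamma> t $ 2)\<^sup>2" if "t \<in> S" for t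
    using low[OF S(1)[OF that]] by (simp add: add_nonneg_pos)
  have logr_sq: "logr p = - ln ((p $ 1)\<^sup>2 + (p $ 2)\<^sup>2) / 2" for p :: "real^2"
    by (simp add: logr_def norm_real2 ln_sqrt)
  show False
  proof (rule riccati_no_backward_solution[of S "\<lambda>t. - (\<gamma> t $ 1) / \<gamma> t $ 2" ?w' "\<lambda>t. logr (\<gamma> t)" ?L'])
    show "is_interval S" unfolding S_def using J by (simp add: is_interval_Int)
    fix t assume t: "t \<in> S"
    show "((\<lambda>t. - (\<gamma> t $ 1) / \<gamma> t $ 2) has_real_derivative ?w' t) (at t)"
      using low[OF S(1)[OF t]]
      by (auto intro!: derivative_eq_intros comp[OF t] simp: field_simps power2_eq_square)
    show "((\<lambda>t. logr (\<gamma> t)) has_real_derivative ?L' t) (at t)"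
    proof -
      define D N where "D s = (\<gamma> s $ 1)\<^sup>2 + (\<gamma> s $ 2)\<^sup>2"
        and "N = \<gamma> t $ 1 * Y_star (\<gamma> t) $ 1 + \<gamma> t $ 2 * Y_star (\<gamma> t) $ 2" for s
      have "(D has_real_derivative 2 * N) (at t)"
        unfolding D_def N_def by (auto intro!: derivative_eq_intros comp[OF t])
      then have "((\<lambda>s. - ln (D s) / 2) has_real_derivative - N / D t) (at t)"
        using sq_pos[OF t] by (auto intro!: derivative_eq_intros simp: D_def[symmetric])
      then show ?thesis by (simp only: logr_sq D_def N_def)
    qed
    show "0 < logr (\<gamma> t)" using S(3)[OF t] by simp
    show "(- (\<gamma> t $ 1) / \<gamma> t $ 2)\<^sup>2 / 2 + 1 / (logr (\<gamma> t) * sqrt (logr (\<gamma> t))) / 4 \<le> ?w' t"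
      by (rule Y_star_polar_estimates) (use S[OF t] low in auto)
    have "\<gamma> t $ 1 * Y_star (\<gamma> t) $ 1 + \<gamma> t $ 2 * Y_star (\<gamma> t) $ 2
        \<le> 2 * ((\<gamma> t $ 1)\<^sup>2 + (\<gamma> t $ 2)\<^sup>2)"
      by (rule Y_star_polar_estimates) (use S[OF t] low in auto)
    then show "- 2 \<le> ?L' t" using sq_pos[OF t] by (simp add: pos_le_divide_eq)
  next
    fix M
    obtain t1 where "t1 \<in> J" "\<forall>t\<in>J. t \<le> t1 \<longrightarrow> norm (\<gamma> t) < exp (- M)"
      using lim[of "exp (- M)"] by auto
    then show "\<exists>t1\<in>S. \<forall>t\<in>S. t \<le> t1 \<longrightarrow> M \<le> logr (\<gamma> t)"
      using t0 logr_large by (intro bexI[of _ "min t0 t1"]) (auto simp: S_def min_def)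
  qed
qed

lemma saddle_backward_limit_diagonal:
  assumes J: "is_interval J"
    and der: "\<And>t. t \<in> J \<Longrightarrow> (\<gamma> has_vector_derivative X_star (\<gamma> t)) (at t)"
    and lim: "\<And>e. 0 < e \<Longrightarrow> \<exists>t1\<in>J. \<forall>t\<in>J. t \<le> t1 \<longrightarrow> norm (\<gamma> t) < e"
    and t: "t \<in> J"
  shows "\<gamma> t $ 1 = \<gamma> t $ 2"
proof (rule ccontr)
  \<comment> \<open>\<open>f\<close> measures the contracting component, which shrinks in time and yet tends to 0 backwards.\<close>
  define f where "f t = (\<gamma> t $ 1 - \<gamma> t $ 2)\<^sup>2" for t
  assume "\<gamma> t $ 1 \<noteq> \<gamma> t $ 2"
  then have "0 < f t" by (simp add: f_def)
  then have "0 < sqrt (f t) / 2" by simp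
  \<comment> \<open>Half of sqrt (f t) suffices because |x - y| is at most twice the norm.\<close>
  then obtain t1 where t1: "t1 \<in> J" "\<forall>s\<in>J. s \<le> t1 \<longrightarrow> norm (\<gamma> s) < sqrt (f t) / 2"
    using lim by blast
  define s where "s = min t t1"
  have s: "s \<in> J" "s \<le> t" "norm (\<gamma> s) < sqrt (f t) / 2" using t t1 by (auto simp: s_def min_def)
  have "- f s \<le> - f t"
  proof (rule nonneg_deriv_le[OF J _ _ s(1) t s(2), of "\<lambda>t. - f t" "\<lambda>t. 2 * f t"])
    fix u assume "u \<in> J"
    note comp = has_real_derivative_vec_nth[OF der[OF this]]
    show "((\<lambda>t. - f t) has_real_derivative 2 * f u) (at u)"
      unfolding f_def
      by (auto intro!: derivative_eq_intros comp simp: X_star_def power2_eq_square algebra_simps)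
    show "0 \<le> 2 * f u" by (simp add: f_def)
  qed
  then have "sqrt (f t) \<le> \<bar>\<gamma> s $ 1 - \<gamma> s $ 2\<bar>"
    by (metis f_def neg_le_iff_le real_sqrt_abs real_sqrt_le_mono)
  also have "\<dots> \<le> \<bar>\<gamma> s $ 1\<bar> + \<bar>\<gamma> s $ 2\<bar>" by simp
  also have "\<dots> \<le> norm (\<gamma> s) + norm (\<gamma> s)" by (intro add_mono component_le_norm_cart)
  finally show False using s(3) by simp
qed

lemma continuous_on_X_star: "continuous_on S X_star"
  unfolding X_star_eq by (simp add: linear_continuous_on linear_XL_star linear_linear)

lemma continuous_on_Y_star: "S \<subseteq> ball 0 1 \<Longrightarrow> continuous_on S Y_star"
  by (intro continuous_at_imp_continuous_on ballI has_derivative_continuous[OF Y_star_has_derivative])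
     auto

text \<open>By connectedness the trajectory stays on one side of the line. The lower side is
  excluded by the focus, and on the upper side the saddle leaves only the diagonal.\<close>

lemma trajectory_from_origin_on_diagonal:
  assumes tr: "trajectory \<U> (X_star, Y_star) U \<gamma> J" and J: "open J" and U: "U \<subseteq> ball 0 1"
    and off: "\<And>t. t \<in> J \<Longrightarrow> \<gamma> t $ 2 \<noteq> 0"
    and lim: "\<And>e. 0 < e \<Longrightarrow> \<exists>t1\<in>J. \<forall>t\<in>J. t \<le> t1 \<longrightarrow> norm (\<gamma> t) < e"
    and t: "t \<in> J"
  shows "\<gamma> t $ 1 = \<gamma> t $ 2 \<and> 0 < \<gamma> t $ 2"
proof -
  have I: "is_interval J" "continuous_on J \<gamma>" "\<gamma> ` J \<subseteq> ball 0 1"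
    using tr U by (auto simp: trajectory_def)
  have "connected ((\<lambda>t. \<gamma> t $ 2) ` J)"
    using I by (intro connected_continuous_image continuous_intros is_interval_connected)
  then have conn: "is_interval ((\<lambda>t. \<gamma> t $ 2) ` J)" by (simp add: is_interval_connected_1)
  have sides: "(\<forall>s\<in>J. 0 < \<gamma> s $ 2) \<or> (\<forall>s\<in>J. \<gamma> s $ 2 < 0)"
  proof (rule ccontr)
    assume "\<not> ?thesis"
    then obtain a b where "a \<in> J" "b \<in> J" "\<gamma> a $ 2 \<le> 0" "0 \<le> \<gamma> b $ 2" by (auto simp: not_less)
    then have "0 \<in> (\<lambda>t. \<gamma> t $ 2) ` J"
      using mem_is_interval_1_I[OF conn, of "\<gamma> a $ 2" "\<gamma> b $ 2" 0] by blast
    then show False using off by force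
  qed
  have "\<not> (\<forall>s\<in>J. \<gamma> s $ 2 < 0)"
  proof
    assume low: "\<forall>s\<in>J. \<gamma> s $ 2 < 0"
    have "(\<gamma> has_vector_derivative Y_star (\<gamma> s)) (at s)" if "s \<in> J" for s
      using trajectory_side_derivative(2)[OF tr J that] low continuous_on_Y_star[OF I(3)] by simp
    from Y_star_no_backward_limit[OF I(1) this] show False using low lim by blast
  qed
  then have up: "\<forall>s\<in>J. 0 < \<gamma> s $ 2" using sides by blast
  have "(\<gamma> has_vector_derivative X_star (\<gamma> s)) (at s)" if "s \<in> J" for s
    using trajectory_side_derivative(1)[OF tr J that] up continuous_on_X_star by simp
  from saddle_backward_limit_diagonal[OF I(1) this lim t] show ?thesis using up t by blast
qed

section \<open>Orbits of the linear part\<close>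

lemma rest_at_origin:
  assumes "0 \<in> \<U>" "0 \<in> U"
  shows "maximal_trajectory \<U> (X_star, Y_star) U (\<lambda>_. 0) UNIV"
proof -
  have "X_star 0 = 0" "Y_star 0 = 0"
    by (auto simp: X_star_def Y_star_def Gam_def vec_eq_iff forall_2)
  then have "Z_Sigma \<U> (X_star, Y_star) 0 = 0" by (simp add: Z_Sigma_def Let_def)
  then show ?thesis
    using assms by (auto simp: maximal_trajectory_def trajectory_def single_arc_def Sigma_line_def)
qed

text \<open>A constant trajectory makes one of the three fields vanish at \<open>p\<close>. The two
  linear fields are injective, and off the origin the Filippov field takes the value of one of
  them.\<close>

lemma linear_equilibrium_unique:
  assumes \<U>: "open \<U>" "0 \<in> \<U>"
    and tr: "trajectory \<U> (XL_star, YL_star) V \<delta> J" and const: "\<And>t. t \<in> J \<Longrightarrow> \<delta> t = p"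
  shows "p = 0"
proof -
  obtain t where t: "t \<in> interior J" using tr by (auto simp: trajectory_def)
  then have tJ: "t \<in> J" using interior_subset by blast
  have stat: "v = 0" if "(\<delta> has_vector_derivative v) (at s)" "s \<in> interior J" for v s
  proof -
    have "(\<delta> has_vector_derivative 0) (at s)"
    proof (rule has_vector_derivative_transform_within_open)
      show "((\<lambda>_. p) has_vector_derivative 0) (at s)" by simp
      show "p = \<delta> y" if "y \<in> interior J" for y using const that interior_subset by blast
    qed (use that in auto)
    then show ?thesis using that(1) vector_derivative_unique_at by blast
  qed
  have "single_arc \<U> (XL_star, YL_star) \<delta> (at t within J \<inter> {t<..})"
    using tr tJ by (simp add: trajectory_def)
  moreover have "at t within J \<inter> {t<..} = at_right t"
    by (rule at_within_nhd[OF t open_interior]) (use interior_subset in blast)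
  ultimately have arc: "single_arc \<U> (XL_star, YL_star) \<delta> (at_right t)" by simp
  have inJ: "\<forall>\<^sub>F s in at_right t. s \<in> interior J"
    using t by (auto intro: eventually_at_in_open' filter_leD[OF at_le] simp: eventually_at_split)
  have wit: "\<exists>s\<in>interior J. P s" if "\<forall>\<^sub>F s in at_right t. P s" for P
    using eventually_happens'[OF trivial_limit_at_right_real eventually_conj[OF that inJ]] by blast
  have *: "p \<in> A \<and> F p = 0"
    if "\<forall>\<^sub>F s in at_right t. \<delta> s \<in> A \<and> (\<delta> has_vector_derivative F (\<delta> s)) (at s)" for A F
    using wit[OF that] stat const interior_subset by (metis subsetD)
  have XL: "XL_star p = 0 \<Longrightarrow> p = 0" and YL: "YL_star p = 0 \<Longrightarrow> p = 0"
    by (auto simp: XL_star_def YL_star_def vec_eq_iff forall_2)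
  from arc consider "XL_star p = 0" | "YL_star p = 0" | "p $ 2 = 0" "Z_Sigma \<U> (XL_star, YL_star) p = 0"
    using *[of "Sigma_plus \<U>" XL_star] *[of "Sigma_minus \<U>" YL_star]
      *[of "Sigma_line \<U>" "Z_Sigma \<U> (XL_star, YL_star)"]
    unfolding single_arc_def fst_conv snd_conv Sigma_line_def by blast
  then show ?thesis
  proof cases
    case 3
    show ?thesis
    proof (rule ccontr)
      assume "p \<noteq> 0"
      then have "p $ 1 \<noteq> 0" using 3 by (simp add: vec_eq_iff forall_2)
      \<comment> \<open>On the line the second components of both fields equal x, so their product
        x^2 is positive: every point other than the origin is a crossing point.\<close>
      then have "0 < p $ 1 * p $ 1" using not_square_less_zero[of "p $ 1"] by (simp add: less_le)
      then have "XL_star p = 0 \<or> YL_star p = 0"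
        using 3 by (auto simp: Z_Sigma_def Let_def XL_star_def YL_star_def split: if_splits)
      then show False using XL YL \<open>p \<noteq> 0\<close> by blast
    qed
  qed (use XL YL in auto)
qed

text \<open>The eigenvalue is 1, so exp t v is a solution inside one half plane, and it tends to 0
  backwards. It is maximal up to its first exit time \<open>T\<close>: by continuity an extension
  would take the value exp T v, which lies outside \<open>V\<close>.\<close>

lemma eigenray_maximal_trajectory:
  assumes V: "open V" "0 \<in> V" "V \<subseteq> \<U>" "V \<subseteq> ball 0 1"
    and eigen: "0 < v $ 2 \<and> XL_star v = v \<or> v $ 2 < 0 \<and> YL_star v = v"
  obtains T where "maximal_trajectory \<U> (XL_star, YL_star) V (\<lambda>t. exp t *\<^sub>R v) {..<T}"
proof -
  define E where "E = {t. exp t *\<^sub>R v \<notin> V}"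
  have "v \<noteq> 0" using eigen by auto
  have "E = - ((\<lambda>t. exp t *\<^sub>R v) -` V)" by (auto simp: E_def)
  moreover have "continuous_on UNIV (\<lambda>t. exp t *\<^sub>R v)" by (intro continuous_intros)
  ultimately have "closed E" using closed_Compl open_vimage V(1) by metis
  \<comment> \<open>At this time the ray reaches the unit circle, so an exit time exists.\<close>
  have "exp (- ln (norm v)) *\<^sub>R v \<notin> V"
    using V(4) \<open>v \<noteq> 0\<close> by (auto simp: exp_minus)
  then have ne: "E \<noteq> {}" by (auto simp: E_def)
  have "((\<lambda>t. exp t *\<^sub>R v) \<longlongrightarrow> 0 *\<^sub>R v) at_bot" by (intro tendsto_intros exp_at_bot)
  then have "\<forall>\<^sub>F t in at_bot. exp t *\<^sub>R v \<in> V" using V(1,2) by (simp add: topological_tendstoD)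
  then obtain N where N: "\<And>t. t \<le> N \<Longrightarrow> exp t *\<^sub>R v \<in> V" by (auto simp: eventually_at_bot_linorder)
  have "N \<le> t" if "t \<in> E" for t using N[of t] that linear[of N t] by (auto simp: E_def)
  then have bdd: "bdd_below E" by (rule bdd_belowI)
  define T where "T = Inf E"
  have T: "T \<in> E" unfolding T_def using ne bdd \<open>closed E\<close> by (rule closed_contains_Inf)
  have inV: "exp t *\<^sub>R v \<in> V" if "t < T" for t
    using that cInf_lower[OF _ bdd, of t] by (force simp: E_def T_def)
  have der: "((\<lambda>t. exp t *\<^sub>R v) has_vector_derivative exp t *\<^sub>R v) (at t)" for t
    by (auto intro!: derivative_eq_intros)
  have arc: "single_arc \<U> (XL_star, YL_star) (\<lambda>t. exp t *\<^sub>R v) (at t within {..<T} \<inter> A)" for t A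
  proof -
    have "\<forall>\<^sub>F s in at t within {..<T} \<inter> A. s < T" by (simp add: eventually_at_filter)
    then have ev: "\<forall>\<^sub>F s in at t within {..<T} \<inter> A. exp s *\<^sub>R v \<in> \<U>"
      by (rule eventually_mono) (use inV V(3) in blast)
    show ?thesis
      using eigen
    proof (elim disjE conjE)
      assume "0 < v $ 2" "XL_star v = v"
      then show ?thesis unfolding single_arc_def
        by (intro disjI1 eventually_mono[OF ev])
           (use der in \<open>auto simp: Sigma_plus_def linear_scale[OF linear_XL_star]\<close>)
    next
      assume "v $ 2 < 0" "YL_star v = v"
      then show ?thesis unfolding single_arc_def
        by (intro disjI2[OF disjI1] eventually_mono[OF ev])
           (use der in \<open>auto simp: Sigma_minus_def linear_scale[OF linear_YL_star] mult_pos_neg\<close>)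
    qed
  qed
  have inner: "T - 1 \<in> interior {..<T}" by (simp add: interior_open)
  have "trajectory \<U> (XL_star, YL_star) V (\<lambda>t. exp t *\<^sub>R v) {..<T}"
    unfolding trajectory_def using arc inV inner by (auto intro!: continuous_intros)
  moreover have "J = {..<T}"
    if \<delta>: "trajectory \<U> (XL_star, YL_star) V \<delta> J" "{..<T} \<subseteq> J" "\<forall>t\<in>{..<T}. \<delta> t = exp t *\<^sub>R v"
    for \<delta> J
  proof (rule ccontr)
    assume "J \<noteq> {..<T}"
    then obtain t where "t \<in> J" "T \<le> t" using \<delta>(2)
      by (metis lessThan_iff not_less subsetI subset_antisym)
    moreover have "is_interval J" using \<delta>(1) by (simp add: trajectory_def)
    moreover have "T - 1 \<in> J" using \<delta>(2) by (simp add: subset_iff)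
    ultimately have "T \<in> J" using mem_is_interval_1_I[of J "T - 1" t T] by simp
    then have "\<delta> T \<in> V" "(\<delta> \<longlongrightarrow> \<delta> T) (at T within J)"
      using \<delta>(1) by (auto simp: trajectory_def continuous_on_def)
    then have "(\<delta> \<longlongrightarrow> \<delta> T) (at_left T)" using \<delta>(2) tendsto_within_subset by blast
    moreover have "((\<lambda>t. exp t *\<^sub>R v) \<longlongrightarrow> exp T *\<^sub>R v) (at_left T)" by (intro tendsto_intros)
    then have "(\<delta> \<longlongrightarrow> exp T *\<^sub>R v) (at_left T)"
      by (rule Lim_transform_eventually) (use \<delta>(3) in \<open>auto simp: eventually_at_filter\<close>)
    ultimately have "\<delta> T = exp T *\<^sub>R v" using tendsto_unique trivial_limit_at_left_real by blast
    then show False using T \<open>\<delta> T \<in> V\<close> by (simp add: E_def)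
  qed
  ultimately show ?thesis using that unfolding maximal_trajectory_def by blast
qed

text \<open>The image under \<open>G\<close> is an orbit of the perturbed field which avoids the
  line and emanates from the origin, so the diagonal lemma applies after passing to the parameter
  supplied by \<open>maps_orbits\<close>.\<close>

lemma image_of_eigenray_on_diagonal:
  assumes G: "maps_orbits \<U> (XL_star, YL_star) V (X_star, Y_star) U G" "continuous_on V G" "G 0 = 0"
    and V: "open V" "0 \<in> V" and U: "U \<subseteq> ball 0 1"
    and off: "\<And>p. p \<in> V \<Longrightarrow> p $ 2 \<noteq> 0 \<Longrightarrow> G p $ 2 \<noteq> 0"
    and ray: "maximal_trajectory \<U> (XL_star, YL_star) V (\<lambda>t. exp t *\<^sub>R v) {..<T}"
    and v: "v $ 2 \<noteq> 0"
  defines "q \<equiv> \<lambda>t. G (exp t *\<^sub>R v)"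
  shows "\<And>t. t < T \<Longrightarrow> q t $ 1 = q t $ 2 \<and> 0 < q t $ 2"
    and "continuous_on {..<T} q" and "(q \<longlongrightarrow> 0) at_bot"
proof -
  have inV: "exp t *\<^sub>R v \<in> V" if "t < T" for t
    using ray that by (auto simp: maximal_trajectory_def trajectory_def)
  show "continuous_on {..<T} q" unfolding q_def
    by (rule continuous_on_compose2[OF G(2)]) (auto intro!: continuous_intros inV)
  have "isCont G 0" using G(2) V by (simp add: continuous_on_eq_continuous_at)
  moreover have "((\<lambda>t. exp t *\<^sub>R v) \<longlongrightarrow> 0 *\<^sub>R v) at_bot" by (intro tendsto_intros exp_at_bot)
  ultimately have "((\<lambda>t. G (exp t *\<^sub>R v)) \<longlongrightarrow> G 0) at_bot"
    using isCont_tendsto_compose[of 0 G "\<lambda>t. exp t *\<^sub>R v" at_bot] by simp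
  then show q0: "(q \<longlongrightarrow> 0) at_bot" by (simp add: q_def G(3))
  obtain \<gamma> J \<tau> where \<gamma>: "maximal_trajectory \<U> (X_star, Y_star) U \<gamma> J"
      and \<tau>: "strict_mono_on {..<T} \<tau>" "\<tau> ` {..<T} = J" and q: "\<And>t. t < T \<Longrightarrow> q t = \<gamma> (\<tau> t)"
    using G(1)[unfolded maps_orbits_def, rule_format, OF ray] by (auto simp: q_def)
  have tr: "trajectory \<U> (X_star, Y_star) U \<gamma> J" using \<gamma> by (simp add: maximal_trajectory_def)
  have \<tau>J: "\<tau> t \<in> J" if "t < T" for t using \<tau>(2) that by blast
  \<comment> \<open>The domain of \<tau> is open and \<tau> is strictly increasing, so each point of
    the interval \<open>J\<close> lies strictly between two others.\<close>
  have "open J"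
    unfolding open_subopen[of J]
  proof
    fix s assume "s \<in> J"
    then obtain t where t: "t < T" "s = \<tau> t" using \<tau>(2) by auto
    obtain t' where t': "t < t'" "t' < T" using t(1) dense by blast
    have "is_interval J" "\<tau> (t - 1) \<in> J" "\<tau> t' \<in> J"
      using \<tau>J t t' tr by (auto simp: trajectory_def)
    then have "{\<tau> (t - 1)<..<\<tau> t'} \<subseteq> J"
      by (meson greaterThanLessThan_iff less_imp_le mem_is_interval_1_I subsetI)
    moreover have "s \<in> {\<tau> (t - 1)<..<\<tau> t'}" using strict_mono_onD[OF \<tau>(1)] t t' by simp
    ultimately show "\<exists>A. open A \<and> s \<in> A \<and> A \<subseteq> J" using open_greaterThanLessThan by meson
  qed
  have off_line: "\<gamma> s $ 2 \<noteq> 0" if s: "s \<in> J" for s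
  proof -
    obtain t where t: "t < T" "s = \<tau> t" using \<tau>(2) s by auto
    then show ?thesis using off[OF inV[OF t(1)]] v q[OF t(1)] by (simp add: q_def)
  qed
  have lim: "\<exists>s1\<in>J. \<forall>s\<in>J. s \<le> s1 \<longrightarrow> norm (\<gamma> s) < e" if e: "0 < e" for e
  proof -
    obtain N where N: "\<And>t. t \<le> N \<Longrightarrow> norm (q t) < e"
      using tendstoD[OF q0 e] by (auto simp: eventually_at_bot_linorder)
    \<comment> \<open>The minimum keeps \<open>t1\<close> inside the domain of the ray; monotonicity
      of \<tau> turns closeness to the origin for early \<open>t\<close> into closeness for early
      points of \<open>J\<close>.\<close>
    define t1 where "t1 = min N (T - 1)"
    have t1: "t1 < T" "t1 \<le> N" by (auto simp: t1_def)
    have "norm (\<gamma> s) < e" if s: "s \<in> J" "s \<le> \<tau> t1" for s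
    proof -
      obtain t where t: "t < T" "s = \<tau> t" using \<tau>(2) s(1) by auto
      then have "t \<le> t1" using strict_mono_on_less_eq[OF \<tau>(1), of t t1] s t1 by simp
      then show ?thesis using N[of t] q[OF t(1)] t t1 by simp
    qed
    then show ?thesis using \<tau>J[OF t1(1)] by blast
  qed
  show "q t $ 1 = q t $ 2 \<and> 0 < q t $ 2" if "t < T" for t
    unfolding q[OF that]
    by (rule trajectory_from_origin_on_diagonal[OF tr \<open>open J\<close> U off_line lim \<tau>J[OF that]])
qed

section \<open>Collision of the images of two eigenrays\<close>

lemma not_locally_Sigma_equivalent_star:
  assumes \<U>: "open \<U>" "0 \<in> \<U>" "\<U> \<subseteq> ball 0 1"
  shows "\<not> locally_Sigma_equivalent \<U> (X_star, Y_star) (XL_star, YL_star)"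
proof
  assume "locally_Sigma_equivalent \<U> (X_star, Y_star) (XL_star, YL_star)"
  then obtain U V H G where U: "open U" "0 \<in> U" "U \<subseteq> \<U>" and V: "open V" "0 \<in> V" "V \<subseteq> \<U>"
    and hom: "homeomorphism U V H G"
    and H: "maps_orbits \<U> (X_star, Y_star) U (XL_star, YL_star) V H"
    and G: "maps_orbits \<U> (XL_star, YL_star) V (X_star, Y_star) U G"
    and line: "H ` (Sigma_line \<U> \<inter> U) = Sigma_line \<U> \<inter> V"
    unfolding locally_Sigma_equivalent_def by blast
  have GH: "\<And>p. p \<in> U \<Longrightarrow> G (H p) = p" "\<And>p. p \<in> V \<Longrightarrow> H (G p) = p" "\<And>p. p \<in> V \<Longrightarrow> G p \<in> U"
    and contG: "continuous_on V G"
    using hom by (auto simp: homeomorphism_def)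
  obtain \<delta> and \<tau> :: "real \<Rightarrow> real"
    where \<delta>: "maximal_trajectory \<U> (XL_star, YL_star) V \<delta> (range \<tau>)" "\<And>t. H 0 = \<delta> (\<tau> t)"
    using H[unfolded maps_orbits_def, rule_format, OF rest_at_origin[OF \<U>(2) U(2)]] by auto
  \<comment> \<open>The constant trajectory at the origin is carried to a trajectory of the linear
    part that is constantly \<open>H 0\<close>, and the origin is the only such value.\<close>
  have "H 0 = 0"
    by (rule linear_equilibrium_unique[OF \<U>(1,2), of V \<delta> "range \<tau>"]) (use \<delta> in \<open>auto simp: maximal_trajectory_def\<close>)
  then have G0: "G 0 = 0" using GH(1)[OF U(2)] by simp
  have off: "G p $ 2 \<noteq> 0" if "p \<in> V" "p $ 2 \<noteq> 0" for p
  proof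
    assume "G p $ 2 = 0"
    then have "H (G p) \<in> Sigma_line \<U> \<inter> V"
      using line GH(3)[OF that(1)] U(3) by (force simp: Sigma_line_def)
    then show False using GH(2) that by (simp add: Sigma_line_def)
  qed
  define u v :: "real^2" where "u = vector [1, 1]" and "v = vector [0, -1]"
  have Vb: "V \<subseteq> ball 0 1" and Ub: "U \<subseteq> ball 0 1" using U V \<U> by auto
  have uv: "0 < u $ 2 \<and> XL_star u = u" "v $ 2 < 0 \<and> YL_star v = v" "u $ 2 \<noteq> 0" "v $ 2 \<noteq> 0"
    by (auto simp: u_def v_def XL_star_def YL_star_def vec_eq_iff forall_2)
  obtain S where S: "maximal_trajectory \<U> (XL_star, YL_star) V (\<lambda>t. exp t *\<^sub>R u) {..<S}"
    by (rule eigenray_maximal_trajectory[OF V Vb, of u]) (use uv in auto)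
  obtain T where T: "maximal_trajectory \<U> (XL_star, YL_star) V (\<lambda>t. exp t *\<^sub>R v) {..<T}"
    by (rule eigenray_maximal_trajectory[OF V Vb, of v]) (use uv in auto)
  define q r where "q t = G (exp t *\<^sub>R u)" and "r t = G (exp t *\<^sub>R v)" for t
  have q: "\<And>t. t < S \<Longrightarrow> q t $ 1 = q t $ 2 \<and> 0 < q t $ 2"
      "continuous_on {..<S} q" "(q \<longlongrightarrow> 0) at_bot"
    using image_of_eigenray_on_diagonal[OF G contG G0 V(1,2) Ub _ S uv(3)] off
    unfolding q_def by blast+
  have r: "\<And>t. t < T \<Longrightarrow> r t $ 1 = r t $ 2 \<and> 0 < r t $ 2"
      "continuous_on {..<T} r" "(r \<longlongrightarrow> 0) at_bot"
    using image_of_eigenray_on_diagonal[OF G contG G0 V(1,2) Ub _ T uv(4)] off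
    unfolding r_def by blast+
  \<comment> \<open>A curve that starts from the origin attains every positive height below one of
    its own heights, by the intermediate value theorem.\<close>
  have meet: "\<exists>s<b. f s $ 2 = c"
    if "continuous_on {..<b} f" "(f \<longlongrightarrow> 0) at_bot" "a < b" "0 < c" "c \<le> f a $ 2"
    for a b c and f :: "real \<Rightarrow> real^2"
  proof -
    have "((\<lambda>t. f t $ 2) \<longlongrightarrow> 0) at_bot" using tendsto_vec_nth[OF that(2), of 2] by simp
    then have "\<forall>\<^sub>F t in at_bot. f t $ 2 < c" using that(4) by (simp add: order_tendstoD)
    then obtain N where N: "\<And>t. t \<le> N \<Longrightarrow> f t $ 2 < c" by (auto simp: eventually_at_bot_linorder)
    have "\<exists>s\<ge>min N a. s \<le> a \<and> f s $ 2 = c"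
    proof (rule IVT')
      show "continuous_on {min N a..a} (\<lambda>t. f t $ 2)"
        by (intro continuous_intros continuous_on_subset[OF that(1)]) (use that(3) in auto)
    qed (use N[of "min N a"] that in auto)
    then obtain s where "s \<le> a" "f s $ 2 = c" by blast
    then show ?thesis using that(3) by (intro exI[of _ s]) simp
  qed
  define c where "c = min (q (S - 1) $ 2) (r (T - 1) $ 2)"
  have c: "0 < c" "c \<le> q (S - 1) $ 2" "c \<le> r (T - 1) $ 2"
    using q(1)[of "S - 1"] r(1)[of "T - 1"] by (auto simp: c_def)
  obtain s where s: "s < S" "q s $ 2 = c" using meet[OF q(2,3) _ c(1,2)] by auto
  obtain t where t: "t < T" "r t $ 2 = c" using meet[OF r(2,3) _ c(1,3)] by auto
  \<comment> \<open>On the diagonal the height determines the point. Injectivity of \<open>G\<close>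
    on \<open>V\<close> then identifies points of two rays lying on opposite sides of the
    line.\<close>
  have "q s = r t" using q(1)[OF s(1)] r(1)[OF t(1)] s t by (simp add: vec_eq_iff forall_2)
  moreover have "exp s *\<^sub>R u \<in> V" "exp t *\<^sub>R v \<in> V"
    using S T s t by (auto simp: maximal_trajectory_def trajectory_def)
  ultimately have "exp s *\<^sub>R u = exp t *\<^sub>R v" using GH(2) unfolding q_def r_def by metis
  then have "(exp s *\<^sub>R u) $ 2 = (exp t *\<^sub>R v) $ 2" by simp
  then have "exp s = - exp t" by (simp add: u_def v_def)
  then show False using exp_gt_zero[of s] exp_gt_zero[of t] by linarith
qed

theorem proposition3p1:
  fixes \<U> :: "(real^2) set"
  assumes "open \<U>" and "bounded \<U>" and "0 \<in> \<U>" and "\<U> \<subseteq> ball 0 1"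
  shows "(X_star, Y_star) \<in> Omega0 \<U> \<and>
         linear_part (X_star, Y_star) = (XL_star, YL_star) \<and>
         \<not> locally_Sigma_equivalent \<U> (X_star, Y_star) (XL_star, YL_star)"
  using X_star_Y_star_in_Omega0 linear_part_star not_locally_Sigma_equivalent_star assms by blast

end
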